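(* Let $\mathcal{B}=(\mathcal{V},\mathcal{E})$ be a finite connected undirected graph with an action of a group $G$ by graph automorphisms. Let $\mathcal{W}$ be the set of $G$-pivot vertices in $\mathcal{B}$ and assume $\mathcal{W}\neq\emptyset$. Let $d=\min\{|Gv|\mid v\in\mathcal{W}\}$. Then $|\mathcal{W}|\leq \beta(\mathcal{B})+2d-1$. Furthermore, the number of $G$-orbits in $\mathcal{W}$ is bounded by $\frac{1}{d}(\beta(\mathcal{B})-1)+2$.
   Context: A finite undirected graph $\mathcal{B}$ has a finite vertex set $\mathcal{V}$ and an edge set $\mathcal{E}$ of $2$-element subsets of $\mathcal{V}$. A vertex $v$ is a $G$-pivot vertex if for every $w\in\mathcal{V}$ with $\{v,w\}\in\mathcal{E}$, the set $\{gw\mid g\in G,\ gv=v\}$ has even cardinality. $Gv$ denotes the $G$-orbit of $v$. The Betti number is $\beta(\mathcal{B})=|\mathcal{E}|-|\mathcal{V}|+1$. *)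

theory Defs
  imports Complex_Main "HOL-Algebra.Group_Action"
begin

locale finite_ugraph =
  fixes V :: "'v set" and E :: "'v set set"
  assumes finite_verts: "finite V"
    and edges_two_subsets: "e \<in> E \<Longrightarrow> e \<subseteq> V \<and> card e = 2"

definition ugraph_connected :: "'v set \<Rightarrow> 'v set set \<Rightarrow> bool" where
  "ugraph_connected V E \<longleftrightarrow>
     V \<noteq> {} \<and> (\<forall>u\<in>V. \<forall>v\<in>V. (u, v) \<in> {(x, y). {x, y} \<in> E}\<^sup>*)"

definition betti_number :: "'v set \<Rightarrow> 'v set set \<Rightarrow> int" where
  "betti_number V E = int (card E) - int (card V) + 1"

locale graph_action = group_action G V \<phi>
  for G :: "('g, 'm) monoid_scheme" (structure) and V :: "'v set" and E :: "'v set set"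
    and \<phi> :: "'g \<Rightarrow> 'v \<Rightarrow> 'v" +
  assumes preserves_adjacency:
    "\<lbrakk>g \<in> carrier G; u \<in> V; v \<in> V\<rbrakk> \<Longrightarrow> {\<phi> g u, \<phi> g v} \<in> E \<longleftrightarrow> {u, v} \<in> E"

definition pivot_vertices ::
  "('g, 'm) monoid_scheme \<Rightarrow> 'v set \<Rightarrow> 'v set set \<Rightarrow> ('g \<Rightarrow> 'v \<Rightarrow> 'v) \<Rightarrow> 'v set" where
  "pivot_vertices G V E \<phi> =
     {v \<in> V. \<forall>w\<in>V. {v, w} \<in> E \<longrightarrow> even (card {\<phi> g w | g. g \<in> carrier G \<and> \<phi> g v = v})}"

end

theory Submission
  imports Defs
begin

text \<open>
  Let \<open>S\<close> be an orbit of pivot vertices of minimal size \<open>d\<close>, and let the level of a vertex be its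
  distance to \<open>S\<close>; it is \<open>G\<close>-invariant. By connectedness, every vertex outside \<open>S\<close> has a neighbour
  of smaller level. For a pivot vertex \<open>u\<close> outside \<open>S\<close> the set of such neighbours contains an
  orbit of the stabiliser of \<open>u\<close>, which is nonempty of even size, so there are at least two.
  Assigning each edge to its endpoint of larger level gives
  \<open>|E| \<ge> (|V| - d) + (|W| - d)\<close>, which is the first bound. The second follows from it, since
  \<open>W\<close> is a disjoint union of orbits of size at least \<open>d\<close>.
\<close>

section \<open>Distance to a set of vertices and neighbours closer to it\<close>

definition adjacency :: "'v set set \<Rightarrow> ('v \<times> 'v) set" where
  "adjacency E = {(x, y). {x, y} \<in> E}"

text \<open>Walks are counted by relation powers, so this is the graph distance from
  \<open>u\<close> to \<open>S\<close>. If no walk reaches \<open>S\<close> the value is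
  unspecified; connectedness and \<open>S \<noteq> {}\<close> exclude that case.\<close>

definition level :: "'v set set \<Rightarrow> 'v set \<Rightarrow> 'v \<Rightarrow> nat" where
  "level E S u = (LEAST n. \<exists>s\<in>S. (u, s) \<in> adjacency E ^^ n)"

definition lower_neighbours :: "'v set set \<Rightarrow> 'v set \<Rightarrow> 'v \<Rightarrow> 'v set" where
  "lower_neighbours E S u = {w. {u, w} \<in> E \<and> level E S w < level E S u}"

lemma level_le: "(u, s) \<in> adjacency E ^^ n \<Longrightarrow> s \<in> S \<Longrightarrow> level E S u \<le> n"
  unfolding level_def by (rule Least_le) blast

lemma level_witness:
  assumes "ugraph_connected V E" "S \<subseteq> V" "S \<noteq> {}" "u \<in> V"
  shows "\<exists>s\<in>S. (u, s) \<in> adjacency E ^^ level E S u"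
proof -
  obtain s where "s \<in> S" using assms(3) by blast
  moreover from this have "(u, s) \<in> (adjacency E)\<^sup>*"
    using assms unfolding ugraph_connected_def adjacency_def by blast
  ultimately have "\<exists>n. \<exists>s\<in>S. (u, s) \<in> adjacency E ^^ n"
    by (meson rtrancl_imp_relpow)
  then show ?thesis
    unfolding level_def by (rule LeastI_ex)
qed

text \<open>The second vertex \<open>w\<close> on a shortest walk from \<open>u\<close> to
  \<open>S\<close> is strictly closer to \<open>S\<close>, because the rest of the walk bounds its
  level.\<close>

lemma lower_neighbours_nonempty:
  assumes "ugraph_connected V E" "S \<subseteq> V" "S \<noteq> {}" "u \<in> V - S"
  shows "lower_neighbours E S u \<noteq> {}"
proof -
  obtain s where s: "s \<in> S" "(u, s) \<in> adjacency E ^^ level E S u"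
    using level_witness assms by (metis DiffD1)
  \<comment> \<open>A walk of length 0 would give \<open>u = s\<close>, against
    \<open>u \<notin> S\<close>.\<close>
  have "level E S u \<noteq> 0"
  proof
    assume "level E S u = 0"
    then show False using s assms(4) by auto
  qed
  then obtain m where m: "level E S u = Suc m" by (metis not0_implies_Suc)
  then obtain w where w: "(u, w) \<in> adjacency E" "(w, s) \<in> adjacency E ^^ m"
    using s(2) by (metis relpow_Suc_D2)
  have "w \<in> lower_neighbours E S u"
    using w level_le[OF w(2) s(1)] m by (simp add: lower_neighbours_def adjacency_def)
  then show ?thesis by blast
qed

section \<open>Counting edges by their endpoint of larger level\<close>

context finite_ugraph
begin

lemma edge_vertices: "{u, w} \<in> E \<Longrightarrow> u \<in> V \<and> w \<in> V"
  using edges_two_subsets by blast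

lemma finite_edges: "finite E"
  by (rule finite_subset[of _ "Pow V"]) (use edges_two_subsets finite_verts in auto)

lemma finite_lower_neighbours: "finite (lower_neighbours E S u)"
  by (rule finite_subset[OF _ finite_verts]) (auto simp: lower_neighbours_def dest: edge_vertices)

lemma sum_card_lower_neighbours_le:
  assumes "finite A"
  shows "(\<Sum>u\<in>A. card (lower_neighbours E S u)) \<le> card E"
proof -
  let ?N = "lower_neighbours E S"
  \<comment> \<open>A collision of \<open>(u, w)\<close> with \<open>(w, u)\<close> would require
    each endpoint to have strictly smaller level than the other.\<close>
  have "inj_on (\<lambda>(u, w). {u, w}) (Sigma A ?N)"
    by (auto simp: inj_on_def lower_neighbours_def doubleton_eq_iff)
  moreover have "(\<lambda>(u, w). {u, w}) ` Sigma A ?N \<subseteq> E"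
    by (auto simp: lower_neighbours_def)
  ultimately have "card (Sigma A ?N) \<le> card E"
    using finite_edges card_inj_on_le by blast
  then show ?thesis
    using assms finite_lower_neighbours by (simp add: card_SigmaI)
qed

end

section \<open>Group actions, levels and pivot vertices\<close>

locale finite_graph_action = finite_ugraph V E + graph_action G V E \<phi>
  for G :: "('g, 'm) monoid_scheme" (structure) and V :: "'v set" and E :: "'v set set"
    and \<phi> :: "'g \<Rightarrow> 'v \<Rightarrow> 'v"
begin

lemma group_G: "group G"
  using group_hom group_hom.axioms(1) by blast

lemma action_closed: "g \<in> carrier G \<Longrightarrow> u \<in> V \<Longrightarrow> \<phi> g u \<in> V"
  using element_image by blast

lemma action_mult:
  "g \<in> carrier G \<Longrightarrow> h \<in> carrier G \<Longrightarrow> u \<in> V \<Longrightarrow> \<phi> (g \<otimes> h) u = \<phi> g (\<phi> h u)"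
  using composition_rule by blast

lemma action_one: "u \<in> V \<Longrightarrow> \<phi> \<one> u = u"
  by (metis id_eq_one restrict_apply')

lemma action_inv_cancel:
  assumes "g \<in> carrier G" "u \<in> V"
  shows "\<phi> (inv g) (\<phi> g u) = u" "\<phi> g (\<phi> (inv g) u) = u"
proof -
  interpret G: group G by (rule group_G)
  show "\<phi> (inv g) (\<phi> g u) = u" using orbit_sym_aux[OF assms refl] .
  show "\<phi> g (\<phi> (inv g) u) = u"
    using orbit_sym_aux[OF G.inv_closed[OF assms(1)] assms(2) refl] assms(1) by simp
qed

lemma action_relpow_adjacency:
  assumes "g \<in> carrier G" "(u, s) \<in> adjacency E ^^ n"
  shows "(\<phi> g u, \<phi> g s) \<in> adjacency E ^^ n"
  using assms(2)
proof (induction n arbitrary: s)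
  case 0
  then show ?case by simp
next
  case (Suc n)
  then obtain t where t: "(u, t) \<in> adjacency E ^^ n" "{t, s} \<in> E"
    by (auto simp: adjacency_def)
  have "{\<phi> g t, \<phi> g s} \<in> E"
    using preserves_adjacency[OF assms(1)] edge_vertices t(2) by blast
  then show ?case
    using Suc.IH[OF t(1)] by (auto simp: adjacency_def)
qed

text \<open>A shortest walk from \<open>u\<close> to \<open>S\<close> is carried by \<open>g\<close>
  to a walk of the same length, which again ends in \<open>S\<close>. The inequality is what keeps
  the image of a lower neighbour of a fixed vertex low.\<close>

lemma level_action_le:
  assumes "ugraph_connected V E" "S \<subseteq> V" "S \<noteq> {}" "\<And>s. s \<in> S \<Longrightarrow> \<phi> g s \<in> S"
    and "g \<in> carrier G" "u \<in> V"
  shows "level E S (\<phi> g u) \<le> level E S u"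
proof -
  obtain s where "s \<in> S" "(u, s) \<in> adjacency E ^^ level E S u"
    using level_witness assms by metis
  then show ?thesis
    using action_relpow_adjacency assms(4,5) level_le by metis
qed

lemma pivot_lower_neighbours_ge_2:
  assumes "ugraph_connected V E" "S \<subseteq> V" "S \<noteq> {}"
    and inv: "\<And>g s. g \<in> carrier G \<Longrightarrow> s \<in> S \<Longrightarrow> \<phi> g s \<in> S"
    and u: "u \<in> pivot_vertices G V E \<phi> - S"
  shows "card (lower_neighbours E S u) \<ge> 2"
proof -
  have uV: "u \<in> V" using u by (simp add: pivot_vertices_def)
  obtain w where w: "w \<in> lower_neighbours E S u"
    using lower_neighbours_nonempty[OF assms(1-3), of u] u uV by blast
  then have wE: "{u, w} \<in> E" and wl: "level E S w < level E S u"
    by (auto simp: lower_neighbours_def)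
  then have wV: "w \<in> V" using edge_vertices by blast
  define B where "B = {\<phi> g w | g. g \<in> carrier G \<and> \<phi> g u = u}"
  have "B \<subseteq> lower_neighbours E S u"
  proof
    fix x assume "x \<in> B"
    then obtain g where g: "g \<in> carrier G" "\<phi> g u = u" "x = \<phi> g w"
      unfolding B_def by blast
    have "{u, \<phi> g w} \<in> E"
      using preserves_adjacency[OF g(1) uV wV] g(2) wE by simp
    moreover have "level E S (\<phi> g w) < level E S u"
      using level_action_le[OF assms(1-3) inv[OF g(1)] g(1) wV] wl by simp
    ultimately show "x \<in> lower_neighbours E S u"
      by (simp add: g(3) lower_neighbours_def)
  qed
  then have le: "card B \<le> card (lower_neighbours E S u)" and fin: "finite B"
    by (rule card_mono[OF finite_lower_neighbours], rule finite_subset[OF _ finite_lower_neighbours])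
  \<comment> \<open>The identity puts \<open>w\<close> itself into \<open>B\<close>; an even
    cardinality other than 0 is at least 2.\<close>
  have "\<phi> \<one> w \<in> B"
    using action_one[OF uV] monoid.one_closed[OF group.is_monoid[OF group_G]]
    unfolding B_def by blast
  then have "card B \<noteq> 0" using fin by auto
  moreover have "even (card B)"
    using u wV wE by (auto simp: B_def pivot_vertices_def)
  ultimately have "card B \<ge> 2" by presburger
  then show ?thesis using le by simp
qed

text \<open>The stabiliser of \<open>\<phi> h v\<close> is the conjugate by \<open>h\<close> of the
  stabiliser of \<open>v\<close>. Hence the orbit of a neighbour \<open>w\<close> of
  \<open>\<phi> h v\<close> is the image under \<open>h\<close> of the orbit of the neighbour
  \<open>\<phi> (inv h) w\<close> of \<open>v\<close>, and the two have the same size.\<close>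

lemma action_pivot_vertices:
  assumes "v \<in> pivot_vertices G V E \<phi>" "h \<in> carrier G"
  shows "\<phi> h v \<in> pivot_vertices G V E \<phi>"
proof -
  have vV: "v \<in> V" using assms(1) by (simp add: pivot_vertices_def)
  interpret G: group G by (rule group_G)
  have "even (card {\<phi> g w | g. g \<in> carrier G \<and> \<phi> g (\<phi> h v) = \<phi> h v})" (is "even (card ?B)")
    if w: "w \<in> V" "{\<phi> h v, w} \<in> E" for w
  proof -
    define w' where "w' = \<phi> (inv h) w"
    have w'V: "w' \<in> V" using w(1) assms(2) by (simp add: w'_def action_closed)
    have hw': "\<phi> h w' = w" using w(1) assms(2) by (simp add: w'_def action_inv_cancel)
    have "{v, w'} \<in> E"
      using preserves_adjacency[OF assms(2) vV w'V] hw' w(2) by simp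
    then have ev: "even (card {\<phi> g w' | g. g \<in> carrier G \<and> \<phi> g v = v})" (is "even (card ?A)")
      using assms(1) w'V by (auto simp: pivot_vertices_def)
    have "?B = \<phi> h ` ?A"
    proof (intro equalityI subsetI)
      fix x assume "x \<in> ?B"
      then obtain g where g: "g \<in> carrier G" "\<phi> g (\<phi> h v) = \<phi> h v" "x = \<phi> g w" by blast
      \<comment> \<open>Conjugating back turns an element fixing \<open>\<phi> h v\<close> into one
        fixing \<open>v\<close>; the reverse inclusion uses the opposite conjugate.\<close>
      let ?k = "inv h \<otimes> g \<otimes> h"
      have k: "\<phi> ?k y = \<phi> (inv h) (\<phi> g (\<phi> h y))" if "y \<in> V" for y
        using that g(1) assms(2) by (simp add: action_mult action_closed)
      have "\<phi> ?k v = v" using k[OF vV] g(2) assms(2) vV by (simp add: action_inv_cancel)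
      moreover have "x = \<phi> h (\<phi> ?k w')"
        using k[OF w'V] hw' g assms(2) w(1) by (simp add: action_inv_cancel action_closed)
      moreover have "?k \<in> carrier G" using g(1) assms(2) by simp
      ultimately show "x \<in> \<phi> h ` ?A" by blast
    next
      fix x assume "x \<in> \<phi> h ` ?A"
      then obtain g where g: "g \<in> carrier G" "\<phi> g v = v" "x = \<phi> h (\<phi> g w')" by blast
      let ?k = "h \<otimes> g \<otimes> inv h"
      have k: "\<phi> ?k (\<phi> h y) = \<phi> h (\<phi> g y)" if "y \<in> V" for y
        using that g(1) assms(2) by (simp add: action_mult action_closed action_inv_cancel)
      have "\<phi> ?k (\<phi> h v) = \<phi> h v" "x = \<phi> ?k w"
        using k[OF vV] k[OF w'V] hw' g by simp_all
      moreover have "?k \<in> carrier G" using g(1) assms(2) by simp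
      ultimately show "x \<in> ?B" by blast
    qed
    moreover have "inj_on (\<phi> h) ?A"
      by (rule inj_on_subset[OF inj_prop[OF assms(2)]]) (use w'V action_closed in auto)
    ultimately show ?thesis using ev by (simp add: card_image)
  qed
  then show ?thesis
    using action_closed[OF assms(2) vV] by (auto simp: pivot_vertices_def)
qed

lemma orbit_subset_pivot_vertices:
  "v \<in> pivot_vertices G V E \<phi> \<Longrightarrow> orbit G \<phi> v \<subseteq> pivot_vertices G V E \<phi>"
  using action_pivot_vertices by (auto simp: orbit_def)

section \<open>The two counting bounds\<close>

lemma card_pivot_vertices_le:
  assumes conn: "ugraph_connected V E" and v: "v \<in> V"
  shows "card (pivot_vertices G V E \<phi>) + card V \<le> card E + 2 * card (orbit G \<phi> v)"
proof -
  let ?W = "pivot_vertices G V E \<phi>" and ?S = "orbit G \<phi> v"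
  have WV: "?W \<subseteq> V" by (auto simp: pivot_vertices_def)
  have SV: "?S \<subseteq> V" using action_closed v by (auto simp: orbit_def)
  have S0: "?S \<noteq> {}" using orbit_refl[OF v] by blast
  have inv: "\<phi> g s \<in> ?S" if gs: "g \<in> carrier G" "s \<in> ?S" for g s
  proof -
    interpret G: group G by (rule group_G)
    obtain h where "h \<in> carrier G" "s = \<phi> h v" using gs by (auto simp: orbit_def)
    then have "\<phi> g s = \<phi> (g \<otimes> h) v" "g \<otimes> h \<in> carrier G"
      using gs v by (simp_all add: action_mult)
    then show ?thesis by (auto simp: orbit_def)
  qed
  have fin: "finite (V - ?S)" "finite ?S" using finite_verts SV finite_subset by auto
  \<comment> \<open>Each vertex outside the orbit gets weight 1, and pivot vertices one more; these
    weights are then bounded termwise by the numbers of lower neighbours.\<close>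
  have "card (V - ?S) + card (?W - ?S) = (\<Sum>u\<in>V - ?S. 1 + (if u \<in> ?W then 1 else 0))"
  proof -
    have "(V - ?S) \<inter> ?W = ?W - ?S" using WV by blast
    then show ?thesis
      using fin(1) by (simp add: sum.distrib sum.If_cases del: One_nat_def)
  qed
  also have "\<dots> \<le> (\<Sum>u\<in>V - ?S. card (lower_neighbours E ?S u))"
  proof (rule sum_mono)
    fix u assume u: "u \<in> V - ?S"
    have "card (lower_neighbours E ?S u) \<noteq> 0"
      using lower_neighbours_nonempty[OF conn SV S0 u] finite_lower_neighbours by simp
    then show "1 + (if u \<in> ?W then 1 else 0) \<le> card (lower_neighbours E ?S u)"
      using pivot_lower_neighbours_ge_2[OF conn SV S0 inv, of u] u by auto
  qed
  also have "\<dots> \<le> card E" by (rule sum_card_lower_neighbours_le[OF fin(1)])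
  finally have "card (V - ?S) + card (?W - ?S) \<le> card E" .
  \<comment> \<open>Removing the orbit loses at most its size from \<open>V\<close> and from
    \<open>?W\<close>, hence the factor 2.\<close>
  moreover have "card V \<le> card (V - ?S) + card ?S" "card ?W \<le> card (?W - ?S) + card ?S"
    using diff_card_le_card_Diff[OF fin(2), of V] diff_card_le_card_Diff[OF fin(2), of ?W] by auto
  ultimately show ?thesis by linarith
qed

text \<open>The orbits of pivot vertices are disjoint, consist of pivot vertices by invariance, and
  have at least \<open>d\<close> elements each.\<close>

lemma card_orbits_pivot_vertices_le:
  assumes d: "\<And>v. v \<in> pivot_vertices G V E \<phi> \<Longrightarrow> d \<le> card (orbit G \<phi> v)"
  shows "d * card (orbits G (pivot_vertices G V E \<phi>) \<phi>) \<le> card (pivot_vertices G V E \<phi>)"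
proof -
  let ?W = "pivot_vertices G V E \<phi>"
  let ?O = "orbits G ?W \<phi>"
  have WV: "?W \<subseteq> V" by (auto simp: pivot_vertices_def)
  have finW: "finite ?W" using WV finite_verts finite_subset by blast
  have sub: "A \<subseteq> ?W" if "A \<in> ?O" for A
    using that orbit_subset_pivot_vertices by (auto simp: orbits_def)
  have "d * card ?O \<le> (\<Sum>A\<in>?O. card A)"
    using sum_bounded_below[of ?O d card] d by (auto simp: orbits_def mult.commute)
  also have "\<dots> = card (\<Union>?O)"
  proof (rule card_Union_disjoint[symmetric])
    \<comment> \<open>Disjointness is inherited from the partition of all of \<open>V\<close> into
      orbits.\<close>
    have "?O \<subseteq> orbits G V \<phi>" using WV by (auto simp: orbits_def)
    then show "pairwise disjnt ?O"
      using disjoint_union by (auto simp: pairwise_def disjnt_def)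
  qed (use sub finW finite_subset in blast)
  also have "\<dots> \<le> card ?W" using sub finW by (intro card_mono) auto
  finally show ?thesis .
qed

end

theorem theorem3p4:
  fixes G :: "('g, 'm) monoid_scheme"
    and V :: "'v set" and E :: "'v set set"
    and \<phi> :: "'g \<Rightarrow> 'v \<Rightarrow> 'v"
    and W :: "'v set" and d :: nat
  assumes "finite_ugraph V E"
    and "ugraph_connected V E"
    and "graph_action G V E \<phi>"
    and "W = pivot_vertices G V E \<phi>"
    and "W \<noteq> {}"
    and "d = Min {card (orbit G \<phi> v) | v. v \<in> W}"
  shows "int (card W) \<le> betti_number V E + 2 * int d - 1
    \<and> real (card (orbits G W \<phi>)) \<le> 1 / real d * (real_of_int (betti_number V E) - 1) + 2"
proof -
  interpret finite_graph_action G V E \<phi>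
    using assms(1,3) by (simp add: finite_graph_action_def)
  have WV: "W \<subseteq> V" using assms(4) by (auto simp: pivot_vertices_def)
  have finW: "finite W" using WV finite_verts finite_subset by blast
  let ?D = "{card (orbit G \<phi> v) | v. v \<in> W}"
  have D: "finite ?D" "?D \<noteq> {}" using finW assms(5) by auto
  have dle: "d \<le> card (orbit G \<phi> v)" if "v \<in> W" for v
    using D(1) assms(6) that by (auto intro: Min_le)
  \<comment> \<open>The minimum is attained, and the orbit of this \<open>v\<close> serves as the
    set from which levels are measured.\<close>
  obtain v where v: "v \<in> W" "d = card (orbit G \<phi> v)"
    using Min_in[OF D] assms(6) by auto
  \<comment> \<open>A finite orbit containing \<open>v\<close> has positive size, so division by
    \<open>real d\<close> is legitimate.\<close>
  have "finite (orbit G \<phi> v)"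
    using orbit_subset_pivot_vertices v(1) assms(4) finW finite_subset by blast
  moreover have "v \<in> orbit G \<phi> v" using orbit_refl v(1) WV by blast
  ultimately have dpos: "d > 0" using v(2) by (auto simp: card_gt_0_iff)
  have first: "int (card W) \<le> betti_number V E + 2 * int d - 1"
    using card_pivot_vertices_le[OF assms(2), of v] v WV assms(4)
    by (auto simp: betti_number_def)
  have "d * card (orbits G W \<phi>) \<le> card W"
    using card_orbits_pivot_vertices_le dle assms(4) by blast
  \<comment> \<open>Chaining both bounds leaves \<open>d\<close> times the number of orbits at most
    \<open>betti_number V E - 1 + 2 * d\<close>; dividing by \<open>d\<close> turns the last term
    into 2.\<close>
  then have "int (d * card (orbits G W \<phi>)) \<le> betti_number V E + 2 * int d - 1"
    using first by linarith
  then have "real_of_int (int (d * card (orbits G W \<phi>)))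
      \<le> real_of_int (betti_number V E + 2 * int d - 1)"
    by (rule of_int_le_iff[THEN iffD2])
  then have "real (card (orbits G W \<phi>)) \<le> 1 / real d * (real_of_int (betti_number V E) - 1) + 2"
    using dpos by (simp add: field_simps)
  with first show ?thesis by blast
qed

end
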